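(* Let $\Delta$ be an arbitrary set of normal defaults over formulas of Deontic Action Logic (DAL), and let $\Phi$ be a $\vdash$-consistent set of DAL formulas. Then for every DAL formula $\varphi$: $\Phi \vdash_{\Delta} \varphi$ (there is a default proof of $\varphi$ from $\Phi$ under $\Delta$) if and only if $\Phi \mid\!\approx_{\Delta} \varphi$ (there is an extension $E$ of $\Phi$ under $\Delta$ with $E \vdash \varphi$).
   Context: DAL syntax: fix a countable set of basic action symbols $\{a_i : i \ge 0\}$. Actions: $\alpha ::= a_i \mid \alpha \sqcup \alpha \mid \alpha \sqcap \alpha \mid \overline{\alpha} \mid 0 \mid 1$. Formulas: $\varphi ::= \neg\varphi \mid \varphi \vee \varphi \mid \alpha = \beta \mid \mathsf{P}(\alpha) \mid \mathsf{F}(\alpha)$, with $\top,\bot,\wedge,\to,\leftrightarrow$ defined as usual. DAL provability $\Phi \vdash \varphi$: there is a finite sequence of formulas ending in $\varphi$, each of which is an axiom, a member of $\Phi$, or obtained by modus ponens from earlier ones. Axioms: a complete set of classical propositional axioms for $\neg,\vee$; a complete set of Boolean algebra axioms for $\sqcup,\sqcap,\overline{\cdot},0,1$ (as equations $\alpha=\beta$) plus $\neg(0=1)$; equality axioms for $=$; substitution $\alpha=\beta \to (\varphi \to \varphi^{\beta}_{\alpha})$ (replacing some occurrences of $\alpha$ by $\beta$); and D1: $\mathsf{P}(\alpha\sqcup\beta)\leftrightarrow(\mathsf{P}(\alpha)\wedge\mathsf{P}(\beta))$, D2: $\mathsf{F}(\alpha\sqcup\beta)\leftrightarrow(\mathsf{F}(\alpha)\wedge\mathsf{F}(\beta))$,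 D3: $\alpha=0 \leftrightarrow (\mathsf{P}(\alpha)\wedge\mathsf{F}(\alpha))$. $\mathrm{Cn}(\Phi)=\{\varphi : \Phi\vdash\varphi\}$; $\Phi$ is $\vdash$-consistent iff $\Phi \not\vdash \bot$. A normal default is an expression $\frac{\pi : \chi}{\chi}$ with $\pi,\chi$ DAL formulas (prerequisite $\pi$, justification = consequent $\chi$). Extensions: for a set of formulas $\Psi$, let $\Gamma^{\Phi}_{\Delta}(\Psi)$ be the smallest set $S$ of formulas with $\Phi\subseteq S$, $S=\mathrm{Cn}(S)$, and such that for every $\frac{\pi:\chi}{\chi}\in\Delta$, if $\pi\in S$ and $\neg\chi\notin\Psi$ then $\chi\in S$. $E$ is an extension of $\Phi$ under $\Delta$ iff $E=\Gamma^{\Phi}_{\Delta}(E)$. $\Phi \mid\!\approx_{\Delta}\varphi$ iff $E\vdash\varphi$ for some extension $E$ of $\Phi$ under $\Delta$. Default proof: a finite sequence $\psi_1,\dots,\psi_n$ with $\psi_n=\varphi$ where each $\psi_k$ is a DAL axiom, a member of $\Phi$, obtained by modus ponens from earlier members, or obtained by default detachment (there is $j<k$ with $\frac{\psi_j:\psi_k}{\psi_k}\in\Delta$), and such that the set $\{\psi_1,\dots,\psi_n\}$ is $\vdash$-consistent. $\Phi\vdash_\Delta\varphi$ iff such a sequence exists.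
   Formalization: A default proof is required to be consistent together with Φ (Φ ∪ {ψ₁,…,ψₙ} consistent), not just {ψ₁,…,ψₙ}; otherwise the claim fails, e.g. for Φ = {P(a₀)} and the default (0=0) : ¬P(a₀) / ¬P(a₀). *)

theory Defs
  imports Main
begin

datatype act =
    Basic nat
  | Join act act
  | Meet act act
  | Compl act
  | Impossible
  | Universal

datatype fm =
    Neg fm
  | Or fm fm
  | Equal act act
  | Perm act
  | Forb act

definition Imp :: "fm \<Rightarrow> fm \<Rightarrow> fm" where
  "Imp p q = Or (Neg p) q"

definition And :: "fm \<Rightarrow> fm \<Rightarrow> fm" where
  "And p q = Neg (Or (Neg p) (Neg q))"

definition Iff :: "fm \<Rightarrow> fm \<Rightarrow> fm" where
  "Iff p q = And (Imp p q) (Imp q p)"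

definition Top :: fm where
  "Top = Or (Equal Impossible Impossible) (Neg (Equal Impossible Impossible))"

definition Bot :: fm where
  "Bot = Neg Top"

text \<open>\<open>act_repl \<alpha> \<beta> \<gamma> \<delta>\<close> (and likewise \<open>fm_repl\<close>): \<open>\<delta>\<close> arises from \<open>\<gamma>\<close> by
  replacing some, possibly none or all, occurrences of \<open>\<alpha>\<close> by \<open>\<beta>\<close>.\<close>

inductive act_repl :: "act \<Rightarrow> act \<Rightarrow> act \<Rightarrow> act \<Rightarrow> bool" for \<alpha> \<beta> :: act where
  keep: "act_repl \<alpha> \<beta> \<gamma> \<gamma>"
| here: "act_repl \<alpha> \<beta> \<alpha> \<beta>"
| join: "act_repl \<alpha> \<beta> \<gamma> \<gamma>' \<Longrightarrow> act_repl \<alpha> \<beta> \<delta> \<delta>' \<Longrightarrow> act_repl \<alpha> \<beta> (Join \<gamma> \<delta>) (Join \<gamma>' \<delta>')"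
| meet: "act_repl \<alpha> \<beta> \<gamma> \<gamma>' \<Longrightarrow> act_repl \<alpha> \<beta> \<delta> \<delta>' \<Longrightarrow> act_repl \<alpha> \<beta> (Meet \<gamma> \<delta>) (Meet \<gamma>' \<delta>')"
| compl: "act_repl \<alpha> \<beta> \<gamma> \<gamma>' \<Longrightarrow> act_repl \<alpha> \<beta> (Compl \<gamma>) (Compl \<gamma>')"

inductive fm_repl :: "act \<Rightarrow> act \<Rightarrow> fm \<Rightarrow> fm \<Rightarrow> bool" for \<alpha> \<beta> :: act where
  neg: "fm_repl \<alpha> \<beta> p p' \<Longrightarrow> fm_repl \<alpha> \<beta> (Neg p) (Neg p')"
| disj: "fm_repl \<alpha> \<beta> p p' \<Longrightarrow> fm_repl \<alpha> \<beta> q q' \<Longrightarrow> fm_repl \<alpha> \<beta> (Or p q) (Or p' q')"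
| equal: "act_repl \<alpha> \<beta> \<gamma> \<gamma>' \<Longrightarrow> act_repl \<alpha> \<beta> \<delta> \<delta>' \<Longrightarrow> fm_repl \<alpha> \<beta> (Equal \<gamma> \<delta>) (Equal \<gamma>' \<delta>')"
| perm: "act_repl \<alpha> \<beta> \<gamma> \<gamma>' \<Longrightarrow> fm_repl \<alpha> \<beta> (Perm \<gamma>) (Perm \<gamma>')"
| forb: "act_repl \<alpha> \<beta> \<gamma> \<gamma>' \<Longrightarrow> fm_repl \<alpha> \<beta> (Forb \<gamma>) (Forb \<gamma>')"

text \<open>The propositional schemas \<open>prop_*\<close> are complete for \<open>Neg\<close> and \<open>Or\<close> together with modus
  ponens; since \<open>Imp\<close> abbreviates \<open>Or (Neg p) q\<close>, the \<open>Or\<close> schemas also link the two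
  readings of implication. The schemas \<open>ba_*\<close> axiomatise Boolean algebras.\<close>

inductive dal_axiom :: "fm \<Rightarrow> bool" where
  prop_K: "dal_axiom (Imp p (Imp q p))"
| prop_S: "dal_axiom (Imp (Imp p (Imp q r)) (Imp (Imp p q) (Imp p r)))"
| prop_contrapos: "dal_axiom (Imp (Imp (Neg p) (Neg q)) (Imp q p))"
| prop_Or1: "dal_axiom (Imp p (Or p q))"
| prop_Or2: "dal_axiom (Imp q (Or p q))"
| prop_OrE: "dal_axiom (Imp (Imp p r) (Imp (Imp q r) (Imp (Or p q) r)))"
| ba_Join_comm: "dal_axiom (Equal (Join \<alpha> \<beta>) (Join \<beta> \<alpha>))"
| ba_Meet_comm: "dal_axiom (Equal (Meet \<alpha> \<beta>) (Meet \<beta> \<alpha>))"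
| ba_Join_assoc: "dal_axiom (Equal (Join (Join \<alpha> \<beta>) \<gamma>) (Join \<alpha> (Join \<beta> \<gamma>)))"
| ba_Meet_assoc: "dal_axiom (Equal (Meet (Meet \<alpha> \<beta>) \<gamma>) (Meet \<alpha> (Meet \<beta> \<gamma>)))"
| ba_Join_absorb: "dal_axiom (Equal (Join \<alpha> (Meet \<alpha> \<beta>)) \<alpha>)"
| ba_Meet_absorb: "dal_axiom (Equal (Meet \<alpha> (Join \<alpha> \<beta>)) \<alpha>)"
| ba_Join_distrib: "dal_axiom (Equal (Join \<alpha> (Meet \<beta> \<gamma>)) (Meet (Join \<alpha> \<beta>) (Join \<alpha> \<gamma>)))"
| ba_Meet_distrib: "dal_axiom (Equal (Meet \<alpha> (Join \<beta> \<gamma>)) (Join (Meet \<alpha> \<beta>) (Meet \<alpha> \<gamma>)))"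
| ba_Join_zero: "dal_axiom (Equal (Join \<alpha> Impossible) \<alpha>)"
| ba_Meet_one: "dal_axiom (Equal (Meet \<alpha> Universal) \<alpha>)"
| ba_Join_compl: "dal_axiom (Equal (Join \<alpha> (Compl \<alpha>)) Universal)"
| ba_Meet_compl: "dal_axiom (Equal (Meet \<alpha> (Compl \<alpha>)) Impossible)"
| nontrivial: "dal_axiom (Neg (Equal Impossible Universal))"
| eq_refl: "dal_axiom (Equal \<alpha> \<alpha>)"
| eq_sym: "dal_axiom (Imp (Equal \<alpha> \<beta>) (Equal \<beta> \<alpha>))"
| eq_trans: "dal_axiom (Imp (Equal \<alpha> \<beta>) (Imp (Equal \<beta> \<gamma>) (Equal \<alpha> \<gamma>)))"
| subst: "fm_repl \<alpha> \<beta> p p' \<Longrightarrow> dal_axiom (Imp (Equal \<alpha> \<beta>) (Imp p p'))"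
| D1: "dal_axiom (Iff (Perm (Join \<alpha> \<beta>)) (And (Perm \<alpha>) (Perm \<beta>)))"
| D2: "dal_axiom (Iff (Forb (Join \<alpha> \<beta>)) (And (Forb \<alpha>) (Forb \<beta>)))"
| D3: "dal_axiom (Iff (Equal \<alpha> Impossible) (And (Perm \<alpha>) (Forb \<alpha>)))"

definition mp_step :: "fm list \<Rightarrow> nat \<Rightarrow> bool" where
  "mp_step \<psi>s k \<longleftrightarrow> (\<exists>i<k. \<exists>j<k. \<psi>s ! i = Imp (\<psi>s ! j) (\<psi>s ! k))"

definition dal_proof :: "fm set \<Rightarrow> fm list \<Rightarrow> bool" where
  "dal_proof \<Phi> \<psi>s \<longleftrightarrow>
     (\<forall>k<length \<psi>s. dal_axiom (\<psi>s ! k) \<or> \<psi>s ! k \<in> \<Phi> \<or> mp_step \<psi>s k)"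

definition proves :: "fm set \<Rightarrow> fm \<Rightarrow> bool" (infix "\<turnstile>" 50) where
  "\<Phi> \<turnstile> \<phi> \<longleftrightarrow> (\<exists>\<psi>s. \<psi>s \<noteq> [] \<and> last \<psi>s = \<phi> \<and> dal_proof \<Phi> \<psi>s)"

definition Cn :: "fm set \<Rightarrow> fm set" where
  "Cn \<Phi> = {\<phi>. \<Phi> \<turnstile> \<phi>}"

definition consistent :: "fm set \<Rightarrow> bool" where
  "consistent \<Phi> \<longleftrightarrow> \<not> \<Phi> \<turnstile> Bot"

datatype normal_default = Normal (prereq: fm) (conseq: fm)

definition default_closed ::
    "fm set \<Rightarrow> normal_default set \<Rightarrow> fm set \<Rightarrow> fm set \<Rightarrow> bool" where
  "default_closed \<Phi> \<Delta> \<Psi> S \<longleftrightarrow>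
     \<Phi> \<subseteq> S \<and> S = Cn S \<and>
     (\<forall>d\<in>\<Delta>. prereq d \<in> S \<and> Neg (conseq d) \<notin> \<Psi> \<longrightarrow> conseq d \<in> S)"

definition Gam :: "fm set \<Rightarrow> normal_default set \<Rightarrow> fm set \<Rightarrow> fm set" where
  "Gam \<Phi> \<Delta> \<Psi> = \<Inter> {S. default_closed \<Phi> \<Delta> \<Psi> S}"

lemma proves_mono: "\<Phi> \<turnstile> \<phi> \<Longrightarrow> \<Phi> \<subseteq> \<Phi>' \<Longrightarrow> \<Phi>' \<turnstile> \<phi>"
  unfolding proves_def dal_proof_def by blast

lemma Cn_mono: "\<Phi> \<subseteq> \<Phi>' \<Longrightarrow> Cn \<Phi> \<subseteq> Cn \<Phi>'"
  using proves_mono unfolding Cn_def by blast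

lemma subset_Cn: "\<Phi> \<subseteq> Cn \<Phi>"
proof
  fix \<phi> assume "\<phi> \<in> \<Phi>"
  then have "dal_proof \<Phi> [\<phi>]" by (simp add: dal_proof_def)
  then have "\<Phi> \<turnstile> \<phi>" unfolding proves_def by (intro exI[of _ "[\<phi>]"]) simp
  then show "\<phi> \<in> Cn \<Phi>" unfolding Cn_def by simp
qed

text \<open>The intersection in \<open>Gam\<close> is itself closed, so it is the smallest closed set.\<close>

lemma Gam_closed: "default_closed \<Phi> \<Delta> \<Psi> (Gam \<Phi> \<Delta> \<Psi>)"
proof -
  have "Cn (Gam \<Phi> \<Delta> \<Psi>) \<subseteq> S" if "default_closed \<Phi> \<Delta> \<Psi> S" for S
  proof -
    have "Gam \<Phi> \<Delta> \<Psi> \<subseteq> S" using that unfolding Gam_def by blast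
    then have "Cn (Gam \<Phi> \<Delta> \<Psi>) \<subseteq> Cn S" by (rule Cn_mono)
    also have "Cn S = S" using that unfolding default_closed_def by simp
    finally show ?thesis .
  qed
  then have "Cn (Gam \<Phi> \<Delta> \<Psi>) \<subseteq> \<Inter> {S. default_closed \<Phi> \<Delta> \<Psi> S}" by (intro Inter_greatest) simp
  then have "Cn (Gam \<Phi> \<Delta> \<Psi>) \<subseteq> Gam \<Phi> \<Delta> \<Psi>" by (simp only: Gam_def)
  then have "Gam \<Phi> \<Delta> \<Psi> = Cn (Gam \<Phi> \<Delta> \<Psi>)" by (intro equalityI subset_Cn)
  moreover have "\<Phi> \<subseteq> Gam \<Phi> \<Delta> \<Psi>" unfolding Gam_def by (auto simp: default_closed_def)
  moreover have "\<forall>d\<in>\<Delta>. prereq d \<in> Gam \<Phi> \<Delta> \<Psi> \<and> Neg (conseq d) \<notin> \<Psi> \<longrightarrow> conseq d \<in> Gam \<Phi> \<Delta> \<Psi>"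
    unfolding Gam_def by (auto simp: default_closed_def)
  ultimately show ?thesis unfolding default_closed_def by (intro conjI)
qed

lemma Gam_least: "default_closed \<Phi> \<Delta> \<Psi> S \<Longrightarrow> Gam \<Phi> \<Delta> \<Psi> \<subseteq> S"
  unfolding Gam_def by blast

definition extension :: "fm set \<Rightarrow> normal_default set \<Rightarrow> fm set \<Rightarrow> bool" where
  "extension \<Phi> \<Delta> E \<longleftrightarrow> E = Gam \<Phi> \<Delta> E"

definition default_consequence :: "fm set \<Rightarrow> normal_default set \<Rightarrow> fm \<Rightarrow> bool" where
  "default_consequence \<Phi> \<Delta> \<phi> \<longleftrightarrow> (\<exists>E. extension \<Phi> \<Delta> E \<and> E \<turnstile> \<phi>)"

definition default_step :: "normal_default set \<Rightarrow> fm list \<Rightarrow> nat \<Rightarrow> bool" where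
  "default_step \<Delta> \<psi>s k \<longleftrightarrow> (\<exists>j<k. Normal (\<psi>s ! j) (\<psi>s ! k) \<in> \<Delta>)"

text \<open>Consistency of the sequence is required jointly with the premises \<open>\<Phi>\<close>. Consistency of
  \<open>set \<psi>s\<close> alone would not suffice: from \<open>\<Phi> = {Perm a}\<close> and the normal default with
  prerequisite \<open>Top\<close> and consequent \<open>Neg (Perm a)\<close> one could then derive \<open>Neg (Perm a)\<close> by a
  sequence that never mentions the premise \<open>Perm a\<close>, although the only extension is \<open>Cn \<Phi>\<close>.\<close>

definition default_proof :: "fm set \<Rightarrow> normal_default set \<Rightarrow> fm list \<Rightarrow> bool" where
  "default_proof \<Phi> \<Delta> \<psi>s \<longleftrightarrow>
     (\<forall>k<length \<psi>s. dal_axiom (\<psi>s ! k) \<or> \<psi>s ! k \<in> \<Phi> \<or> mp_step \<psi>s k \<or> default_step \<Delta> \<psi>s k) \<and>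
     consistent (\<Phi> \<union> set \<psi>s)"

definition default_provable :: "fm set \<Rightarrow> normal_default set \<Rightarrow> fm \<Rightarrow> bool" where
  "default_provable \<Phi> \<Delta> \<phi> \<longleftrightarrow> (\<exists>\<psi>s. \<psi>s \<noteq> [] \<and> last \<psi>s = \<phi> \<and> default_proof \<Phi> \<Delta> \<psi>s)"

end

theory Submission
  imports Defs
begin

text \<open>
  For a set \<open>D\<close> of defaults read as plain inference rules, let \<open>der \<Phi> D\<close> be the set of formulas
  derivable from \<open>\<Phi>\<close>. Then \<open>Gam \<Phi> \<Delta> \<Psi> = der \<Phi> {d \<in> \<Delta>. Neg (conseq d) \<notin> \<Psi>}\<close>, so every member of
  an extension \<open>E\<close> has a derivation staying inside \<open>E\<close>, which is consistent because \<open>\<Phi>\<close> is.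

  Conversely, call a set \<open>A\<close> grounded if \<open>A \<subseteq> der \<Phi> {d \<in> \<Delta>. conseq d \<in> A}\<close>. The formulas of a
  default proof together with \<open>\<Phi>\<close> form a consistent grounded set; Zorn's lemma enlarges it to a
  maximal one, and since all defaults are normal, maximality makes it an extension.
\<close>

section \<open>Derivations with defaults as an inductive set and as sequences\<close>

inductive_set der :: "fm set \<Rightarrow> normal_default set \<Rightarrow> fm set"
  for \<Phi> :: "fm set" and D :: "normal_default set" where
  ax: "dal_axiom p \<Longrightarrow> p \<in> der \<Phi> D"
| prem: "p \<in> \<Phi> \<Longrightarrow> p \<in> der \<Phi> D"
| mp: "Imp p q \<in> der \<Phi> D \<Longrightarrow> p \<in> der \<Phi> D \<Longrightarrow> q \<in> der \<Phi> D"
| detach: "Normal p q \<in> D \<Longrightarrow> p \<in> der \<Phi> D \<Longrightarrow> q \<in> der \<Phi> D"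

lemma der_conseq: "d \<in> D \<Longrightarrow> prereq d \<in> der \<Phi> D \<Longrightarrow> conseq d \<in> der \<Phi> D"
  by (rule der.detach[where p = "prereq d"]) simp_all

text \<open>This is \<open>default_proof\<close> without its consistency clause, so that sequences
  can be concatenated freely.\<close>

definition deriv_seq :: "fm set \<Rightarrow> normal_default set \<Rightarrow> fm list \<Rightarrow> bool" where
  "deriv_seq \<Phi> D \<psi>s \<longleftrightarrow>
     (\<forall>k<length \<psi>s. dal_axiom (\<psi>s ! k) \<or> \<psi>s ! k \<in> \<Phi> \<or> mp_step \<psi>s k \<or> default_step D \<psi>s k)"

lemma deriv_seq_subset_der:
  assumes "deriv_seq \<Phi> D \<psi>s"
  shows "set \<psi>s \<subseteq> der \<Phi> D"
proof -
  have "k < length \<psi>s \<Longrightarrow> \<psi>s ! k \<in> der \<Phi> D" for k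
  proof (induction k rule: less_induct)
    case (less k)
    then have "dal_axiom (\<psi>s ! k) \<or> \<psi>s ! k \<in> \<Phi> \<or> mp_step \<psi>s k \<or> default_step D \<psi>s k"
      using assms unfolding deriv_seq_def by blast
    moreover have IH: "\<psi>s ! i \<in> der \<Phi> D" if "i < k" for i
      using less that by simp
    ultimately show ?case
      unfolding mp_step_def default_step_def
      by (elim disjE exE conjE; metis IH der.ax der.prem der.mp der.detach)
  qed
  then show ?thesis
    by (auto simp: in_set_conv_nth)
qed

lemma deriv_seq_append:
  assumes "deriv_seq \<Phi> D xs" "deriv_seq \<Phi> D ys"
  shows "deriv_seq \<Phi> D (xs @ ys)"
  unfolding deriv_seq_def
proof (intro allI impI)
  fix k assume k: "k < length (xs @ ys)"
  let ?ok = "\<lambda>zs k. dal_axiom (zs ! k) \<or> zs ! k \<in> \<Phi> \<or> mp_step zs k \<or> default_step D zs k"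
  show "?ok (xs @ ys) k"
  proof (cases "k < length xs")
    case True
    then have "?ok xs k"
      using assms(1) unfolding deriv_seq_def by blast
    moreover have "(xs @ ys) ! i = xs ! i" if "i \<le> k" for i
      using that True by (simp add: nth_append)
    ultimately show ?thesis
      unfolding mp_step_def default_step_def by (auto simp: less_imp_le)
  next
    case False
    define m where "m = k - length xs"
    have km: "k = length xs + m" and m: "m < length ys"
      using False k by (auto simp: m_def)
    have nth: "(xs @ ys) ! (length xs + i) = ys ! i" for i
      by (simp add: nth_append)
    have "?ok ys m"
      using assms(2) m unfolding deriv_seq_def by blast
    moreover have "mp_step (xs @ ys) k" if step: "mp_step ys m"
    proof -
      obtain i j where "i < m" "j < m" "ys ! i = Imp (ys ! j) (ys ! m)"
        using step unfolding mp_step_def by blast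
      then show ?thesis
        unfolding mp_step_def km
        by (intro exI[of _ "length xs + i"] exI[of _ "length xs + j"] conjI) (auto simp: nth)
    qed
    moreover have "default_step D (xs @ ys) k" if step: "default_step D ys m"
    proof -
      obtain j where "j < m" "Normal (ys ! j) (ys ! m) \<in> D"
        using step unfolding default_step_def by blast
      then show ?thesis
        unfolding default_step_def km
        by (intro exI[of _ "length xs + j"] conjI) (auto simp: nth)
    qed
    ultimately show ?thesis
      unfolding km nth by blast
  qed
qed

lemma deriv_seq_snoc:
  assumes "deriv_seq \<Phi> D xs"
    and "dal_axiom q \<or> q \<in> \<Phi> \<or> (\<exists>p \<in> set xs. Imp p q \<in> set xs \<or> Normal p q \<in> D)"
  shows "deriv_seq \<Phi> D (xs @ [q])"
  unfolding deriv_seq_def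
proof (intro allI impI)
  fix k assume k: "k < length (xs @ [q])"
  show "dal_axiom ((xs @ [q]) ! k) \<or> (xs @ [q]) ! k \<in> \<Phi> \<or> mp_step (xs @ [q]) k
    \<or> default_step D (xs @ [q]) k"
  proof (cases "k < length xs")
    case True
    then have "dal_axiom (xs ! k) \<or> xs ! k \<in> \<Phi> \<or> mp_step xs k \<or> default_step D xs k"
      using assms(1) unfolding deriv_seq_def by blast
    moreover have "(xs @ [q]) ! i = xs ! i" if "i \<le> k" for i
      using that True by (simp add: nth_append)
    ultimately show ?thesis
      unfolding mp_step_def default_step_def by (auto simp: less_imp_le)
  next
    case False
    with k have "k = length xs"
      by simp
    with assms(2) show ?thesis
      unfolding mp_step_def default_step_def by (metis in_set_conv_nth nth_append nth_append_length)
  qed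
qed

text \<open>Sequences for the two premises of modus ponens are concatenated before the conclusion is
  appended; this gives access to rule induction in place of list indices.\<close>

lemma der_iff_deriv_seq:
  "p \<in> der \<Phi> D \<longleftrightarrow> (\<exists>\<psi>s. \<psi>s \<noteq> [] \<and> last \<psi>s = p \<and> deriv_seq \<Phi> D \<psi>s)"
proof
  assume "p \<in> der \<Phi> D"
  then show "\<exists>\<psi>s. \<psi>s \<noteq> [] \<and> last \<psi>s = p \<and> deriv_seq \<Phi> D \<psi>s"
  proof induction
    case (ax p)
    then have "deriv_seq \<Phi> D ([] @ [p])"
      by (intro deriv_seq_snoc) (auto simp: deriv_seq_def)
    then show ?case
      by (intro exI[of _ "[p]"]) simp
  next
    case (prem p)
    then have "deriv_seq \<Phi> D ([] @ [p])"
      by (intro deriv_seq_snoc) (auto simp: deriv_seq_def)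
    then show ?case
      by (intro exI[of _ "[p]"]) simp
  next
    case (mp p q)
    then obtain xs ys where xs: "xs \<noteq> []" "last xs = Imp p q" "deriv_seq \<Phi> D xs"
      and ys: "ys \<noteq> []" "last ys = p" "deriv_seq \<Phi> D ys"
      by blast
    have "p \<in> set (xs @ ys)" "Imp p q \<in> set (xs @ ys)"
      using xs ys last_in_set by force+
    then have "deriv_seq \<Phi> D ((xs @ ys) @ [q])"
      by (intro deriv_seq_snoc deriv_seq_append xs ys) blast
    then show ?case
      by (intro exI[of _ "(xs @ ys) @ [q]"]) simp
  next
    case (detach p q)
    then obtain xs where xs: "xs \<noteq> []" "last xs = p" "deriv_seq \<Phi> D xs"
      by blast
    then have "p \<in> set xs"
      using last_in_set by blast
    then have "deriv_seq \<Phi> D (xs @ [q])"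
      using detach by (intro deriv_seq_snoc xs) blast
    then show ?case
      by (intro exI[of _ "xs @ [q]"]) simp
  qed
next
  assume "\<exists>\<psi>s. \<psi>s \<noteq> [] \<and> last \<psi>s = p \<and> deriv_seq \<Phi> D \<psi>s"
  then show "p \<in> der \<Phi> D"
    using deriv_seq_subset_der last_in_set by blast
qed

section \<open>The consequence operator, \<open>der\<close> and \<open>Gam\<close>\<close>

lemma Cn_eq_der: "Cn \<Phi> = der \<Phi> {}"
  unfolding Cn_def proves_def dal_proof_def set_eq_iff der_iff_deriv_seq deriv_seq_def
    default_step_def by simp

lemma consistent_iff: "consistent \<Phi> \<longleftrightarrow> Bot \<notin> Cn \<Phi>"
  by (simp add: consistent_def Cn_def)

lemma der_mono:
  assumes "\<Phi> \<subseteq> \<Phi>'" "D \<subseteq> D'"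
  shows "der \<Phi> D \<subseteq> der \<Phi>' D'"
proof
  fix p assume "p \<in> der \<Phi> D"
  then show "p \<in> der \<Phi>' D'"
    by induction (use assms in \<open>auto intro: der.intros\<close>)
qed

lemma der_least:
  assumes "\<Phi> \<subseteq> S" "Cn S \<subseteq> S" "\<And>p q. Normal p q \<in> D \<Longrightarrow> p \<in> S \<Longrightarrow> q \<in> S"
  shows "der \<Phi> D \<subseteq> S"
proof
  fix p assume "p \<in> der \<Phi> D"
  then show "p \<in> S"
  proof induction
    case (mp p q)
    then have "q \<in> der S {}"
      by (meson der.mp der.prem)
    then show ?case
      using assms(2) by (auto simp: Cn_eq_der)
  qed (use assms in \<open>auto simp: Cn_eq_der intro: der.ax\<close>)
qed

lemma Cn_der: "Cn (der \<Phi> D) = der \<Phi> D"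
proof
  show "Cn (der \<Phi> D) \<subseteq> der \<Phi> D"
  proof
    fix p assume "p \<in> Cn (der \<Phi> D)"
    then have "p \<in> der (der \<Phi> D) {}"
      by (simp add: Cn_eq_der)
    then show "p \<in> der \<Phi> D"
      by induction (auto intro: der.intros)
  qed
qed (rule subset_Cn)

lemma Cn_idem: "Cn (Cn \<Phi>) = Cn \<Phi>"
  using Cn_der[of \<Phi> "{}"] by (simp add: Cn_eq_der)

text \<open>Since \<Psi> is fixed, the justification test does not depend on the set being closed.
  It only selects which defaults act as rules, and the smallest closed set is the one these rules
  generate.\<close>

lemma Gam_eq_der: "Gam \<Phi> \<Delta> \<Psi> = der \<Phi> {d \<in> \<Delta>. Neg (conseq d) \<notin> \<Psi>}"
proof
  let ?D = "{d \<in> \<Delta>. Neg (conseq d) \<notin> \<Psi>}"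
  show "Gam \<Phi> \<Delta> \<Psi> \<subseteq> der \<Phi> ?D"
  proof (rule Gam_least)
    show "default_closed \<Phi> \<Delta> \<Psi> (der \<Phi> ?D)"
      unfolding default_closed_def by (auto simp: Cn_der intro: der.prem der_conseq)
  qed
  show "der \<Phi> ?D \<subseteq> Gam \<Phi> \<Delta> \<Psi>"
    using Gam_closed[of \<Phi> \<Delta> \<Psi>] unfolding default_closed_def
    by (intro der_least) force+
qed

section \<open>Propositional reasoning and compactness for \<open>Cn\<close>\<close>

lemma deduction:
  assumes "q \<in> Cn (insert p A)"
  shows "Imp p q \<in> Cn A"
  using assms unfolding Cn_eq_der
proof induction
  case (ax q)
  then show ?case
    by (meson der.ax der.mp prop_K)
next
  case (prem q)
  have "Imp p p \<in> der A {}"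
    by (meson der.ax der.mp prop_K prop_S)
  with prem show ?case
    by (metis der.ax der.mp der.prem insert_iff prop_K)
next
  case (mp r q)
  then show ?case
    by (meson der.ax der.mp prop_S)
\<comment> \<open>The rule set is empty, so the \<open>detach\<close> case is vacuous.\<close>
qed simp

lemma Cn_mp: "Imp p q \<in> Cn A \<Longrightarrow> p \<in> Cn A \<Longrightarrow> q \<in> Cn A"
  unfolding Cn_eq_der by (rule der.mp)

lemma Cn_ax: "dal_axiom p \<Longrightarrow> p \<in> Cn A"
  unfolding Cn_eq_der by (rule der.ax)

lemma Cn_Neg_Neg:
  assumes "Neg (Neg p) \<in> Cn A"
  shows "p \<in> Cn A"
proof -
  \<comment> \<open>Weakening by the fourfold negation of \<open>p\<close> prepares two
    contrapositions, each stripping one negation from both sides and swapping them.\<close>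
  have "Imp (Neg (Neg (Neg (Neg p)))) (Neg (Neg p)) \<in> Cn A"
    by (rule Cn_mp[OF Cn_ax[OF prop_K] assms])
  then have "Imp (Neg p) (Neg (Neg (Neg p))) \<in> Cn A"
    by (rule Cn_mp[OF Cn_ax[OF prop_contrapos]])
  then have "Imp (Neg (Neg p)) p \<in> Cn A"
    by (rule Cn_mp[OF Cn_ax[OF prop_contrapos]])
  then show ?thesis
    using assms by (rule Cn_mp)
qed

lemma Cn_explode:
  assumes "Neg p \<in> Cn A" "p \<in> Cn A"
  shows "q \<in> Cn A"
proof -
  have "Imp (Neg q) (Neg p) \<in> Cn A"
    by (rule Cn_mp[OF Cn_ax[OF prop_K] assms(1)])
  then have "Imp p q \<in> Cn A"
    by (rule Cn_mp[OF Cn_ax[OF prop_contrapos]])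
  then show ?thesis
    using assms(2) by (rule Cn_mp)
qed

lemma Top_in_Cn: "Top \<in> Cn A"
  unfolding Top_def by (rule Cn_mp[OF Cn_ax[OF prop_Or1] Cn_ax[OF eq_refl]])

lemma Cn_Neg_if_inconsistent:
  assumes "\<not> consistent (insert p A)"
  shows "Neg p \<in> Cn A"
proof -
  \<comment> \<open>\<open>prop_contrapos\<close> only removes negations, so the hypothesis is
    \<open>Neg (Neg p)\<close> and the target \<open>Neg Top\<close>: contraposition then yields
    \<open>Imp Top (Neg p)\<close>.\<close>
  let ?B = "insert (Neg (Neg p)) A"
  have "Neg (Neg p) \<in> Cn ?B"
    using subset_Cn by blast
  then have "p \<in> Cn ?B"
    by (rule Cn_Neg_Neg)
  moreover have "Imp p Bot \<in> Cn ?B"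
    using deduction[of Bot p A] assms Cn_mono[of A ?B] by (auto simp: consistent_iff)
  ultimately have "Neg Top \<in> Cn ?B"
    unfolding Bot_def[symmetric] by (metis Cn_mp)
  then have "Imp (Neg (Neg p)) (Neg Top) \<in> Cn A"
    by (rule deduction)
  then show ?thesis
    using Top_in_Cn Cn_mp Cn_ax prop_contrapos by blast
qed

lemma inconsistent_Cn: "\<not> consistent A \<Longrightarrow> Cn A = UNIV"
  using Cn_explode[of Top A] Top_in_Cn by (auto simp: consistent_iff Bot_def)

text \<open>Compactness: of the two chain members supporting the premises of modus ponens, the
  larger supports both. Nonemptiness of \<open>C\<close> serves the axiom case.\<close>

lemma Cn_Union_chain:
  assumes "subset.chain \<A> C" "C \<noteq> {}" "p \<in> Cn (\<Union>C)"
  shows "\<exists>A\<in>C. p \<in> Cn A"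
  using assms(3) unfolding Cn_eq_der
proof induction
  case (mp p q)
  then obtain A B where AB: "A \<in> C" "B \<in> C" "Imp p q \<in> der A {}" "p \<in> der B {}"
    by blast
  then have "A \<subseteq> B \<or> B \<subseteq> A"
    using assms(1) by (auto simp: subset_chain_def)
  then obtain X where "X \<in> C" "Imp p q \<in> der X {}" "p \<in> der X {}"
    using AB der_mono[of A B "{}" "{}"] der_mono[of B A "{}" "{}"] by blast
  then show ?case
    by (meson der.mp)
qed (use assms(2) in \<open>auto intro: der.intros\<close>)

section \<open>Extensions and maximal grounded sets\<close>

lemma extension_consistent:
  assumes "consistent \<Phi>" "extension \<Phi> \<Delta> E"
  shows "consistent E"
proof (rule ccontr)
  have E: "E = der \<Phi> {d \<in> \<Delta>. Neg (conseq d) \<notin> E}"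
    using assms(2) unfolding extension_def Gam_eq_der .
  assume "\<not> consistent E"
  then have univ: "E = UNIV"
    using inconsistent_Cn Cn_der E by metis
  \<comment> \<open>The full set contains the negation of every consequent, so every default is
    blocked and only the rules of \<open>Cn\<close> remain.\<close>
  then have "E = Cn \<Phi>"
    using E by (simp add: Cn_eq_der)
  then show False
    using univ assms(1) by (auto simp: consistent_iff)
qed

definition grounded :: "fm set \<Rightarrow> normal_default set \<Rightarrow> fm set \<Rightarrow> bool" where
  "grounded \<Phi> \<Delta> A \<longleftrightarrow> A \<subseteq> der \<Phi> {d \<in> \<Delta>. conseq d \<in> A}"

text \<open>Maximality is used twice: against \<open>Cn E\<close> it gives deductive closure, and
  against \<open>E\<close> with one more consequent it gives closure under unblocked
  defaults.\<close>

lemma extension_if_maximal: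
  assumes cons: "consistent E" and gr: "grounded \<Phi> \<Delta> E" and sub: "\<Phi> \<subseteq> E"
    and max: "\<And>A. E \<subseteq> A \<Longrightarrow> consistent A \<Longrightarrow> grounded \<Phi> \<Delta> A \<Longrightarrow> A = E"
  shows "extension \<Phi> \<Delta> E"
proof -
  let ?rules = "\<lambda>A. {d \<in> \<Delta>. conseq d \<in> A}"
  have der: "A \<subseteq> der \<Phi> (?rules B)" if "A \<subseteq> der \<Phi> (?rules E)" "E \<subseteq> B" for A B
    using that der_mono[of \<Phi> \<Phi> "?rules E" "?rules B"] by blast
  have "Cn E \<subseteq> der \<Phi> (?rules E)"
    using Cn_mono[OF gr[unfolded grounded_def]] by (simp add: Cn_der)
  then have "grounded \<Phi> \<Delta> (Cn E)"
    unfolding grounded_def using subset_Cn by (rule der)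
  moreover have "consistent (Cn E)"
    using cons by (simp add: consistent_iff Cn_idem)
  ultimately have Cn: "Cn E = E"
    using max subset_Cn by blast
  have "conseq d \<in> E" if d: "d \<in> \<Delta>" "prereq d \<in> E" "Neg (conseq d) \<notin> E" for d
  proof -
    let ?A = "insert (conseq d) E"
    have "E \<subseteq> der \<Phi> (?rules ?A)"
      using gr unfolding grounded_def by (rule der) blast
    moreover from this have "conseq d \<in> der \<Phi> (?rules ?A)"
      using d by (intro der_conseq) auto
    ultimately have "grounded \<Phi> \<Delta> ?A"
      unfolding grounded_def by blast
    \<comment> \<open>Normality enters here: the justification is the consequent itself, so passing
      the test against the closed set \<open>E\<close> means that adding the consequent is
      consistent.\<close>
    moreover have "consistent ?A"
      using Cn_Neg_if_inconsistent[of "conseq d" E] d Cn by blast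
    ultimately have "?A = E"
      using max by blast
    then show ?thesis by blast
  qed
  then have "default_closed \<Phi> \<Delta> E E"
    using sub Cn by (simp add: default_closed_def)
  then have "Gam \<Phi> \<Delta> E \<subseteq> E"
    by (rule Gam_least)
  \<comment> \<open>By consistency, every default whose consequent lies in \<open>E\<close> passes
    the justification test, so groundedness yields the other inclusion.\<close>
  moreover have "Neg q \<notin> E" if "q \<in> E" for q
    using Cn_explode[of q E Bot] cons that Cn by (auto simp: consistent_iff)
  then have "der \<Phi> (?rules E) \<subseteq> Gam \<Phi> \<Delta> E"
    unfolding Gam_eq_der by (intro der_mono) auto
  then have "E \<subseteq> Gam \<Phi> \<Delta> E"
    using gr unfolding grounded_def by blast
  ultimately show ?thesis
    unfolding extension_def by blast
qed

lemma grounded_extends_to_extension: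
  assumes "consistent A" "grounded \<Phi> \<Delta> A" "\<Phi> \<subseteq> A"
  shows "\<exists>E. extension \<Phi> \<Delta> E \<and> A \<subseteq> E"
proof -
  let ?F = "{B. A \<subseteq> B \<and> consistent B \<and> grounded \<Phi> \<Delta> B}"
  have "\<exists>M\<in>?F. \<forall>X\<in>?F. M \<subseteq> X \<longrightarrow> X = M"
  proof (rule subset_Zorn_nonempty)
    show "?F \<noteq> {}"
      using assms by blast
    fix C assume C: "C \<noteq> {}" "subset.chain ?F C"
    then have CF: "C \<subseteq> ?F"
      by (simp add: subset_chain_def)
    \<comment> \<open>By compactness, a derivation of \<open>Bot\<close> from the union would
      already exist from one member of the chain.\<close>
    have "consistent (\<Union>C)"
      using Cn_Union_chain[OF C(2,1), of Bot] CF by (auto simp: consistent_iff)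
    moreover have "B \<subseteq> der \<Phi> {d \<in> \<Delta>. conseq d \<in> \<Union>C}" if "B \<in> C" for B
      using that CF der_mono[of \<Phi> \<Phi> "{d \<in> \<Delta>. conseq d \<in> B}" "{d \<in> \<Delta>. conseq d \<in> \<Union>C}"]
      unfolding grounded_def by blast
    then have "grounded \<Phi> \<Delta> (\<Union>C)"
      unfolding grounded_def by blast
    ultimately show "\<Union>C \<in> ?F"
      using C CF by blast
  qed
  then obtain M where M: "M \<in> ?F" and max: "\<forall>X\<in>?F. M \<subseteq> X \<longrightarrow> X = M" ..
  have "extension \<Phi> \<Delta> M"
  proof (rule extension_if_maximal)
    fix X assume "M \<subseteq> X" "consistent X" "grounded \<Phi> \<Delta> X"
    moreover from this M have "X \<in> ?F"
      by auto
    ultimately show "X = M"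
      using max by simp
  qed (use M assms(3) in auto)
  then show ?thesis
    using M by blast
qed

theorem theorem1:
  fixes \<Delta> :: "normal_default set" and \<Phi> :: "fm set" and \<phi> :: fm
  assumes "consistent \<Phi>"
  shows "default_provable \<Phi> \<Delta> \<phi> \<longleftrightarrow> default_consequence \<Phi> \<Delta> \<phi>"
proof
  assume "default_provable \<Phi> \<Delta> \<phi>"
  then obtain \<psi>s where \<psi>s: "\<psi>s \<noteq> []" "last \<psi>s = \<phi>" "deriv_seq \<Phi> \<Delta> \<psi>s"
    and cons: "consistent (\<Phi> \<union> set \<psi>s)"
    unfolding default_provable_def default_proof_def deriv_seq_def by blast
  let ?A = "\<Phi> \<union> set \<psi>s"
  \<comment> \<open>A formula obtained by default detachment occurs in the sequence, so its default
    has its consequent in \<open>?A\<close>.\<close>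
  have "deriv_seq \<Phi> {d \<in> \<Delta>. conseq d \<in> ?A} \<psi>s"
    using \<psi>s(3) unfolding deriv_seq_def default_step_def by auto
  then have "grounded \<Phi> \<Delta> ?A"
    unfolding grounded_def using deriv_seq_subset_der by (auto intro: der.prem)
  then obtain E where E: "extension \<Phi> \<Delta> E" "?A \<subseteq> E"
    using grounded_extends_to_extension cons by blast
  then have "\<phi> \<in> E"
    using \<psi>s last_in_set by blast
  then have "E \<turnstile> \<phi>"
    using subset_Cn unfolding Cn_def by blast
  with E show "default_consequence \<Phi> \<Delta> \<phi>"
    unfolding default_consequence_def by blast
next
  assume "default_consequence \<Phi> \<Delta> \<phi>"
  then obtain E where ext: "extension \<Phi> \<Delta> E" and "E \<turnstile> \<phi>"
    unfolding default_consequence_def by blast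
  define D where "D = {d \<in> \<Delta>. Neg (conseq d) \<notin> E}"
  have E: "E = der \<Phi> D"
    using ext unfolding extension_def Gam_eq_der D_def .
  have "\<phi> \<in> der \<Phi> D"
    using \<open>E \<turnstile> \<phi>\<close> Cn_der[of \<Phi> D] E by (auto simp: Cn_def)
  then obtain \<psi>s where \<psi>s: "\<psi>s \<noteq> []" "last \<psi>s = \<phi>" "deriv_seq \<Phi> D \<psi>s"
    using der_iff_deriv_seq by blast
  \<comment> \<open>The whole sequence, not only its last formula, stays inside \<open>E\<close>;
    joint consistency with the premises is inherited from \<open>E\<close>.\<close>
  have "\<Phi> \<union> set \<psi>s \<subseteq> E"
    using deriv_seq_subset_der[OF \<psi>s(3)] E by (auto intro: der.prem)
  then have "consistent (\<Phi> \<union> set \<psi>s)"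
    using extension_consistent[OF assms ext] Cn_mono by (meson consistent_iff subsetD)
  moreover have "deriv_seq \<Phi> \<Delta> \<psi>s"
    using \<psi>s(3) unfolding deriv_seq_def default_step_def D_def by auto
  ultimately show "default_provable \<Phi> \<Delta> \<phi>"
    using \<psi>s unfolding default_provable_def default_proof_def deriv_seq_def by blast
qed

end
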